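(* Consider the single-resource loss model with capacity $b$ and $m$ request classes with parameters $(\lambda_i,\mu_i,b_i,r_i)$, $\rho_i=\lambda_i/\mu_i$, initially empty. For $t\ge 0$ let $R^*(t)$ be the optimal value of the linear program $$\max_{\alpha}\ \sum_{i=1}^m r_i\rho_i\alpha_i\quad\text{s.t.}\quad \sum_{i=1}^m b_i\rho_i\alpha_i\le b,\qquad 0\le\alpha_i\le 1-e^{-\mu_i t},\ i=1,\dots,m.$$ Let $\alpha^*$ be an optimal solution of the steady state linear program $$\max_{\alpha}\ \sum_{i=1}^m r_i\rho_i\alpha_i\quad\text{s.t.}\quad \sum_{i=1}^m b_i\rho_i\alpha_i\le b,\qquad 0\le\alpha_i\le 1,\ i=1,\dots,m,$$ and let $(u^*,\mathbf v^* )$ be an optimal solution of its dual $$\min_{u,\mathbf v}\ ub+\sum_{i=1}^m v_i\quad\text{s.t.}\quad v_i+b_i\rho_i u\ge r_i\rho_i,\ i=1,\dots,m,\qquad \mathbf v\ge \mathbf 0,\ u\ge 0.$$ Then for every feasible policy $\pi$ and every $t\ge 0$ the reward rate $R^\pi(t)$ satisfies $$\mathbf E[R^\pi(t)]\le R^*(t)\le \min\Big\{\sum_{i=1}^m r_i\rho_i(1-e^{-\mu_i t}),\ \sum_{i=1}^m r_i\rho_i\alpha_i^*(1-e^{-\mu_i t})+u^*b\,e^{-\mu_{\min}t}\Big\},$$ where $\mu_{\min}=\min_{1\le i\le m}\mu_i$.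
   Context: Single-resource loss model. One resource has capacity $b\in(0,\infty)$. There are $m$ independent Poisson arrival streams; class $i$ requests arrive at rate $\lambda_i>0$, each requests capacity $b_i>0$, has an independent service duration $S_i\sim\exp(\mu_i)$ (exponential with rate $\mu_i>0$), and pays reward $r_i\ge0$ per unit time while in service. There is no waiting room: each arriving request is, at its arrival instant, either accepted (it then occupies $b_i$ units of capacity for its service duration and releases them on departure) or rejected (lost). Requests may be rejected even when capacity is available. The system is empty just before time $0$. A feasible policy $\pi$ is a rule choosing accept/reject at each arrival epoch, where each decision is measurable with respect to the $\sigma$-algebra generated by the arrival epochs up to that time, the past decisions and the past of the state process, and such that $\sum_{i=1}^m b_i x_i^\pi(t)\le b$ for all $t\ge0$, where $x_i^\pi(t)$ is the number of class $i$ requests in service at time $t$. The reward rate is $R^\pi(t)=\sum_{i=1}^m r_i x_i^\pi(t)$. *)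

theory Defs
  imports "HOL-Probability.Probability"
begin

text \<open>
  Classes are indexed by \<open>{1..m}\<close>, the requests of a class by the naturals in order of
  arrival. \<open>A i n\<close> is the interarrival time preceding request \<open>n\<close> of class \<open>i\<close>,
  so that a Poisson stream of rate \<open>lam i\<close> is given by independent exponential gaps; \<open>S i n\<close>
  is the service duration of that request and \<open>D i n\<close> the event that it is accepted.
\<close>

locale loss_model = prob_space M
  for M :: "'a measure" +
  fixes m :: nat
    and b :: real
    and lam mu cap rew :: "nat \<Rightarrow> real"
    and A S :: "nat \<Rightarrow> nat \<Rightarrow> 'a \<Rightarrow> real"
  assumes classes: "1 \<le> m"
    and capacity_pos: "0 < b"
    and lam_pos: "\<And>i. i \<in> {1..m} \<Longrightarrow> 0 < lam i"
    and mu_pos: "\<And>i. i \<in> {1..m} \<Longrightarrow> 0 < mu i"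
    and cap_pos: "\<And>i. i \<in> {1..m} \<Longrightarrow> 0 < cap i"
    and rew_nonneg: "\<And>i. i \<in> {1..m} \<Longrightarrow> 0 \<le> rew i"
    and interarrival_exponential:
      "\<And>i n. i \<in> {1..m} \<Longrightarrow> distributed M lborel (A i n) (exponential_density (lam i))"
    and service_exponential:
      "\<And>i n. i \<in> {1..m} \<Longrightarrow> distributed M lborel (S i n) (exponential_density (mu i))"
    and independent:
      "indep_vars (\<lambda>_. borel) (case_sum (\<lambda>(i, n). A i n) (\<lambda>(i, n). S i n))
         (({1..m} \<times> UNIV) <+> ({1..m} \<times> UNIV))"

definition arrival_epoch :: "(nat \<Rightarrow> nat \<Rightarrow> 'a \<Rightarrow> real) \<Rightarrow> nat \<Rightarrow> nat \<Rightarrow> 'a \<Rightarrow> real" where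
  "arrival_epoch A i n \<omega> = (\<Sum>k\<le>n. A i k \<omega>)"

text \<open>
  Number of class \<open>i\<close> requests in service at time \<open>t\<close>; no request is present before the first
  arrival. The set is almost surely finite, so that \<open>card\<close> is the true count.
\<close>

definition in_service ::
  "(nat \<Rightarrow> nat \<Rightarrow> 'a \<Rightarrow> real) \<Rightarrow> (nat \<Rightarrow> nat \<Rightarrow> 'a \<Rightarrow> real) \<Rightarrow> (nat \<Rightarrow> nat \<Rightarrow> 'a \<Rightarrow> bool)
    \<Rightarrow> nat \<Rightarrow> real \<Rightarrow> 'a \<Rightarrow> nat" where
  "in_service A S D i t \<omega> =
     card {n. D i n \<omega> \<and> arrival_epoch A i n \<omega> \<le> t \<and> t < arrival_epoch A i n \<omega> + S i n \<omega>}"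

text \<open>
  The information available at the random epoch \<open>arrival_epoch A i n\<close>. The three families of
  generators describe the arrival epochs up to and including that epoch, the decisions at strictly
  earlier epochs, and the state at strictly earlier times. Each generator is cut down to the
  event that what it describes has already happened, so nothing later is revealed.
\<close>

definition history ::
  "'a measure \<Rightarrow> nat \<Rightarrow> (nat \<Rightarrow> nat \<Rightarrow> 'a \<Rightarrow> real) \<Rightarrow> (nat \<Rightarrow> nat \<Rightarrow> 'a \<Rightarrow> real)
    \<Rightarrow> (nat \<Rightarrow> nat \<Rightarrow> 'a \<Rightarrow> bool) \<Rightarrow> nat \<Rightarrow> nat \<Rightarrow> 'a measure" where
  "history M m A S D i n = sigma (space M)
     ({{\<omega> \<in> space M. arrival_epoch A j k \<omega> \<le> arrival_epoch A i n \<omega> \<and> arrival_epoch A j k \<omega> \<le> s} |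
         j k s. j \<in> {1..m}} \<union>
      {{\<omega> \<in> space M. arrival_epoch A j k \<omega> < arrival_epoch A i n \<omega> \<and> D j k \<omega>} |
         j k. j \<in> {1..m}} \<union>
      {{\<omega> \<in> space M. s < arrival_epoch A i n \<omega> \<and> in_service A S D j s \<omega> = q} |
         j s q. j \<in> {1..m} \<and> 0 \<le> s})"

text \<open>
  Measurability of the decisions with respect to \<open>M\<close> follows from non-anticipation up to a null
  set only: the history refers to the decisions themselves, and on the null event that some epoch
  has infinitely many predecessors this reference is not well-founded.
\<close>

definition feasible_policy ::
  "'a measure \<Rightarrow> nat \<Rightarrow> real \<Rightarrow> (nat \<Rightarrow> real) \<Rightarrow> (nat \<Rightarrow> nat \<Rightarrow> 'a \<Rightarrow> real)
    \<Rightarrow> (nat \<Rightarrow> nat \<Rightarrow> 'a \<Rightarrow> real) \<Rightarrow> (nat \<Rightarrow> nat \<Rightarrow> 'a \<Rightarrow> bool) \<Rightarrow> bool" where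
  "feasible_policy M m b cap A S D \<longleftrightarrow>
     (\<forall>i\<in>{1..m}. \<forall>n. D i n \<in> measurable M (count_space UNIV)) \<and>
     (\<forall>i\<in>{1..m}. \<forall>n. D i n \<in> measurable (history M m A S D i n) (count_space UNIV)) \<and>
     (AE \<omega> in M. \<forall>t\<ge>0. (\<Sum>i=1..m. cap i * real (in_service A S D i t \<omega>)) \<le> b)"

definition reward_rate ::
  "nat \<Rightarrow> (nat \<Rightarrow> real) \<Rightarrow> (nat \<Rightarrow> nat \<Rightarrow> 'a \<Rightarrow> real) \<Rightarrow> (nat \<Rightarrow> nat \<Rightarrow> 'a \<Rightarrow> real)
    \<Rightarrow> (nat \<Rightarrow> nat \<Rightarrow> 'a \<Rightarrow> bool) \<Rightarrow> real \<Rightarrow> 'a \<Rightarrow> real" where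
  "reward_rate m rew A S D t \<omega> = (\<Sum>i=1..m. rew i * real (in_service A S D i t \<omega>))"

definition lp_feasible ::
  "nat \<Rightarrow> real \<Rightarrow> (nat \<Rightarrow> real) \<Rightarrow> (nat \<Rightarrow> real) \<Rightarrow> (nat \<Rightarrow> real) \<Rightarrow> (nat \<Rightarrow> real) \<Rightarrow> bool" where
  "lp_feasible m b cap rho ub \<alpha> \<longleftrightarrow>
     (\<Sum>i=1..m. cap i * rho i * \<alpha> i) \<le> b \<and> (\<forall>i\<in>{1..m}. 0 \<le> \<alpha> i \<and> \<alpha> i \<le> ub i)"

definition lp_objective :: "nat \<Rightarrow> (nat \<Rightarrow> real) \<Rightarrow> (nat \<Rightarrow> real) \<Rightarrow> (nat \<Rightarrow> real) \<Rightarrow> real" where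
  "lp_objective m rew rho \<alpha> = (\<Sum>i=1..m. rew i * rho i * \<alpha> i)"

definition lp_value ::
  "nat \<Rightarrow> real \<Rightarrow> (nat \<Rightarrow> real) \<Rightarrow> (nat \<Rightarrow> real) \<Rightarrow> (nat \<Rightarrow> real) \<Rightarrow> (nat \<Rightarrow> real) \<Rightarrow> real" where
  "lp_value m b cap rew rho ub =
     (SUP \<alpha>\<in>{\<alpha>. lp_feasible m b cap rho ub \<alpha>}. lp_objective m rew rho \<alpha>)"

definition dual_feasible ::
  "nat \<Rightarrow> (nat \<Rightarrow> real) \<Rightarrow> (nat \<Rightarrow> real) \<Rightarrow> (nat \<Rightarrow> real) \<Rightarrow> real \<times> (nat \<Rightarrow> real) \<Rightarrow> bool" where
  "dual_feasible m cap rew rho = (\<lambda>(u, v).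
     (\<forall>i\<in>{1..m}. rew i * rho i \<le> v i + cap i * rho i * u \<and> 0 \<le> v i) \<and> 0 \<le> u)"

definition dual_objective :: "nat \<Rightarrow> real \<Rightarrow> real \<times> (nat \<Rightarrow> real) \<Rightarrow> real" where
  "dual_objective m b = (\<lambda>(u, v). u * b + (\<Sum>i=1..m. v i))"

end

theory Submission
  imports Defs
begin

text \<open>
  Let \<open>x\<^sub>i\<close> be the number of class \<open>i\<close> requests in service at time \<open>t\<close>. For a feasible policy the
  scaled means \<open>E[x\<^sub>i] / \<rho>\<^sub>i\<close> form a feasible point of the time-\<open>t\<close> linear program whose objective
  value is the expected reward rate (\<open>mean_occupancy_lp_feasible\<close>, \<open>expectation_reward_rate\<close>);
  this is the first inequality. Their capacity constraint is the expectation of the almost sure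
  one. Their upper bound \<open>1 - e\<^bsup>-\<mu>\<^sub>i t\<^esup>\<close> holds because the requests in service are among those that
  would be in service if every request were accepted, that is, in the infinite-server queue
  \<open>M/M/\<infinity>\<close> started empty, whose mean occupancy at time \<open>t\<close> is \<open>\<rho>\<^sub>i (1 - e\<^bsup>-\<mu>\<^sub>i t\<^esup>)\<close>
  (\<open>expected_uncontrolled_in_service\<close>). That mean is the sum over \<open>n\<close> of the probabilities that
  request \<open>n\<close> has arrived by time \<open>t\<close> and is still present. Since the Erlang densities of the
  arrival epochs add up to the constant arrival rate, the sum is
  \<open>\<integral>\<^sub>0\<^sup>t \<lambda>\<^sub>i e\<^bsup>-\<mu>\<^sub>i (t - s)\<^esup> ds\<close>.

  The upper bounds on the value of the time-\<open>t\<close> program are deterministic. The first one drops the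
  capacity constraint. For the second one, the steady-state dual solution \<open>(u, v)\<close> is feasible for
  the dual of the time-\<open>t\<close> program too, since only the bounds on the variables, hence
  only the dual objective, depend on \<open>t\<close>. Weak duality bounds the value by
  \<open>\<Sum>\<^sub>i v\<^sub>i (1 - e\<^bsup>-\<mu>\<^sub>i t\<^esup>) + u b\<close> (\<open>lp_objective_le_scaled_dual\<close>). Strong duality for the
  steady-state program, a fractional knapsack (\<open>knapsack_strong_duality\<close>), compares this with the
  objective at the steady-state optimum \<open>\<alpha>\<close> scaled by the factors \<open>1 - e\<^bsup>-\<mu>\<^sub>i t\<^esup>\<close>, which it exceeds
  by at most
  \<open>u b e\<^bsup>-\<mu>\<^sub>m\<^sub>i\<^sub>n t\<^esup>\<close> (\<open>scaled_dual_le_scaled_primal\<close>).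
\<close>

section \<open>The infinite-server system\<close>

text \<open>
  The renewal density of a Poisson process is its rate: the \<open>n\<close>-th Erlang density at \<open>s\<close> is \<open>l\<close>
  times the Poisson probability of \<open>n\<close> events in \<open>[0, s]\<close>, and these probabilities sum to one.
\<close>

lemma erlang_density_sums:
  assumes "0 \<le> s"
  shows "(\<lambda>n. erlang_density n l s) sums l"
proof -
  have "(\<lambda>n. (l * s) ^ n /\<^sub>R fact n) sums exp (l * s)"
    by (rule exp_converges)
  then have "(\<lambda>n. (l * exp (- l * s)) * ((l * s) ^ n /\<^sub>R fact n)) sums ((l * exp (- l * s)) * exp (l * s))"
    by (rule sums_mult)
  moreover have "(l * exp (- l * s)) * exp (l * s) = l"
    by (simp add: exp_minus)
  moreover have "(\<lambda>n. (l * exp (- l * s)) * ((l * s) ^ n /\<^sub>R fact n)) = (\<lambda>n. erlang_density n l s)"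
    using assms by (auto simp: erlang_density_def fun_eq_iff field_simps power_mult_distrib)
  ultimately show ?thesis by (simp only:)
qed

text \<open>
  Conditioning on the arrival time: a request that arrived at \<open>s \<le> t\<close> is present at \<open>t\<close> exactly
  if its service duration exceeds \<open>t - s\<close>.
\<close>

lemma (in prob_space) emeasure_present_at:
  fixes T S :: "'a \<Rightarrow> real"
  assumes indep: "indep_var borel S borel T"
    and T: "distributed M lborel T f"
    and S: "distributed M lborel S (exponential_density \<mu>)"
    and \<mu>: "0 < \<mu>"
  shows "emeasure M {\<omega> \<in> space M. T \<omega> \<le> t \<and> t < T \<omega> + S \<omega>}
    = (\<integral>\<^sup>+s. f s * (indicator {..t} s * ennreal (exp (- (t - s) * \<mu>))) \<partial>lborel)"
proof -
  have [measurable]: "T \<in> borel_measurable M" "S \<in> borel_measurable M"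
    using distributed_measurable[OF T] distributed_measurable[OF S] by simp_all
  interpret S: prob_space "distr M borel S" by (rule prob_space_distr) simp
  interpret T: prob_space "distr M borel T" by (rule prob_space_distr) simp
  interpret ST: pair_prob_space "distr M borel S" "distr M borel T" ..
  let ?B = "{p. snd p \<le> t \<and> t < snd p + fst p} :: (real \<times> real) set"
  have B[measurable]: "?B \<in> sets (borel \<Otimes>\<^sub>M borel)"
  proof -
    have "{p \<in> space (borel \<Otimes>\<^sub>M borel). snd p \<le> t \<and> t < snd p + fst p} \<in> sets (borel \<Otimes>\<^sub>M (borel :: real measure))"
      by measurable
    then show ?thesis by (simp add: space_pair_measure)
  qed
  have "emeasure M {\<omega> \<in> space M. T \<omega> \<le> t \<and> t < T \<omega> + S \<omega>}
      = emeasure (distr M (borel \<Otimes>\<^sub>M borel) (\<lambda>\<omega>. (S \<omega>, T \<omega>))) ?B"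
    by (subst emeasure_distr) (auto intro!: arg_cong[where f = "emeasure M"])
  also have "\<dots> = emeasure (distr M borel S \<Otimes>\<^sub>M distr M borel T) ?B"
    using indep by (simp add: indep_var_distribution_eq)
  also have "\<dots> = (\<integral>\<^sup>+s. emeasure (distr M borel S) ((\<lambda>x. (x, s)) -` ?B) \<partial>distr M borel T)"
    by (rule ST.emeasure_pair_measure_alt2) (use B in simp)
  also have "\<dots> = (\<integral>\<^sup>+s. indicator {..t} s * ennreal (exp (- (t - s) * \<mu>)) \<partial>distr M borel T)"
  proof (intro nn_integral_cong)
    fix s :: real
    show "emeasure (distr M borel S) ((\<lambda>x. (x, s)) -` ?B) = indicator {..t} s * ennreal (exp (- (t - s) * \<mu>))"
    proof (cases "s \<le> t")
      case True
      then have "emeasure (distr M borel S) ((\<lambda>x. (x, s)) -` ?B) = emeasure (distr M borel S) {t - s<..}"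
        by (intro arg_cong[where f = "emeasure _"]) auto
      also have "\<dots> = emeasure M {\<omega> \<in> space M. t - s < S \<omega>}"
        by (subst emeasure_distr) (auto intro!: arg_cong[where f = "emeasure M"])
      also have "\<dots> = exp (- (t - s) * \<mu>)"
        using exponential_distributedD_gt[OF S _ \<mu>, of "t - s"] True by (simp add: emeasure_eq_measure)
      finally show ?thesis using True by simp
    qed simp
  qed
  also have "\<dots> = (\<integral>\<^sup>+\<omega>. indicator {..t} (T \<omega>) * ennreal (exp (- (t - T \<omega>) * \<mu>)) \<partial>M)"
    by (rule nn_integral_distr) simp_all
  also have "\<dots> = (\<integral>\<^sup>+s. f s * (indicator {..t} s * ennreal (exp (- (t - s) * \<mu>))) \<partial>lborel)"
    by (rule distributed_nn_integral[OF T, symmetric]) simp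
  finally show ?thesis .
qed

lemma nn_integral_exponential_survival:
  fixes \<mu> t l :: real
  assumes "0 < \<mu>" "0 \<le> l" "0 \<le> t"
  shows "(\<integral>\<^sup>+s. ennreal (l * exp (- (t - s) * \<mu>)) * indicator {0..t} s \<partial>lborel)
    = ennreal (l / \<mu> * (1 - exp (- \<mu> * t)))"
proof -
  have "(\<integral>\<^sup>+s. ennreal (l * exp (- (t - s) * \<mu>)) * indicator {0..t} s \<partial>lborel)
      = ennreal (l / \<mu> * exp (- (t - t) * \<mu>) - l / \<mu> * exp (- (t - 0) * \<mu>))"
    using assms
    by (intro nn_integral_FTC_Icc[where F = "\<lambda>s. l / \<mu> * exp (- (t - s) * \<mu>)"])
       (auto intro!: derivative_eq_intros)
  then show ?thesis by (simp add: algebra_simps)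
qed

context loss_model
begin

lemma
  assumes i: "i \<in> {1..m}"
  shows arrival_epoch_erlang: "distributed M lborel (arrival_epoch A i n) (erlang_density n (lam i))"
    and service_indep_arrival_epoch: "indep_var borel (S i n) borel (arrival_epoch A i n)"
proof -
  let ?X = "case_sum (\<lambda>(i, n). A i n) (\<lambda>(i, n). S i n)"
  let ?I = "(\<lambda>k. Inl (i, k)) ` {..n} :: (nat \<times> nat + nat \<times> nat) set"
  have inj: "inj_on (\<lambda>k. Inl (i, k) :: nat \<times> nat + nat \<times> nat) {..n}"
    by (auto simp: inj_on_def)
  have sum_eq: "(\<lambda>\<omega>. \<Sum>j\<in>?I. ?X j \<omega>) = arrival_epoch A i n"
    by (simp add: fun_eq_iff arrival_epoch_def sum.reindex[OF inj])
  have "indep_vars (\<lambda>_. borel) ?X (insert (Inr (i, n)) ?I)"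
    by (rule indep_vars_subset[OF independent]) (use i in auto)
  then have "indep_var borel (?X (Inr (i, n))) borel (\<lambda>\<omega>. \<Sum>j\<in>?I. ?X j \<omega>)"
    by (intro indep_vars_sum) auto
  then show "indep_var borel (S i n) borel (arrival_epoch A i n)"
    by (simp add: sum_eq)
  have "distributed M lborel (\<lambda>\<omega>. \<Sum>j\<in>?I. ?X j \<omega>) (erlang_density (card ?I - 1) (lam i))"
  proof (rule exponential_distributed_sum)
    show "indep_vars (\<lambda>_. borel) ?X ?I"
      by (rule indep_vars_subset[OF independent]) (use i in auto)
  qed (use i lam_pos interarrival_exponential in auto)
  then show "distributed M lborel (arrival_epoch A i n) (erlang_density n (lam i))"
    unfolding sum_eq by (simp add: card_image[OF inj])
qed

lemma arrival_epoch_measurable: "i \<in> {1..m} \<Longrightarrow> arrival_epoch A i n \<in> borel_measurable M"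
  using distributed_measurable[OF arrival_epoch_erlang] by simp

lemma service_measurable: "i \<in> {1..m} \<Longrightarrow> S i n \<in> borel_measurable M"
  using distributed_measurable[OF service_exponential] by simp

text \<open>The mean occupancy of the \<open>M/M/\<infinity>\<close> queue at time \<open>t\<close> after an empty start.\<close>

lemma expected_uncontrolled_in_service:
  assumes i: "i \<in> {1..m}" and t: "0 \<le> t"
  shows "(\<Sum>n. emeasure M {\<omega> \<in> space M. arrival_epoch A i n \<omega> \<le> t \<and> t < arrival_epoch A i n \<omega> + S i n \<omega>})
    = ennreal (lam i / mu i * (1 - exp (- mu i * t)))"
proof -
  let ?w = "\<lambda>s. indicator {..t} s * ennreal (exp (- (t - s) * mu i))"
  have lam: "0 < lam i" and mu: "0 < mu i" using i lam_pos mu_pos by auto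
  have "(\<Sum>n. emeasure M {\<omega> \<in> space M. arrival_epoch A i n \<omega> \<le> t \<and> t < arrival_epoch A i n \<omega> + S i n \<omega>})
      = (\<Sum>n. \<integral>\<^sup>+s. ennreal (erlang_density n (lam i) s) * ?w s \<partial>lborel)"
    by (intro suminf_cong emeasure_present_at service_indep_arrival_epoch arrival_epoch_erlang
        service_exponential i mu)
  also have "\<dots> = (\<integral>\<^sup>+s. (\<Sum>n. ennreal (erlang_density n (lam i) s) * ?w s) \<partial>lborel)"
    by (rule nn_integral_suminf[symmetric]) measurable
  also have "\<dots> = (\<integral>\<^sup>+s. ennreal (lam i * exp (- (t - s) * mu i)) * indicator {0..t} s \<partial>lborel)"
  proof (intro nn_integral_cong)
    fix s :: real
    show "(\<Sum>n. ennreal (erlang_density n (lam i) s) * ?w s)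
        = ennreal (lam i * exp (- (t - s) * mu i)) * indicator {0..t} s"
    proof (cases "0 \<le> s")
      case True
      have "(\<Sum>n. ennreal (erlang_density n (lam i) s)) = ennreal (lam i)"
        using erlang_density_sums[OF True, of "lam i"] lam
        by (intro suminf_ennreal_eq) auto
      then have "(\<Sum>n. ennreal (erlang_density n (lam i) s) * ?w s) = ennreal (lam i) * ?w s"
        by simp
      also have "\<dots> = ennreal (lam i * exp (- (t - s) * mu i)) * indicator {0..t} s"
        using True lam by (auto simp: ennreal_mult indicator_def)
      finally show ?thesis .
    qed (auto simp: erlang_density_def)
  qed
  also have "\<dots> = ennreal (lam i / mu i * (1 - exp (- mu i * t)))"
    by (rule nn_integral_exponential_survival) (use lam mu t in auto)
  finally show ?thesis .
qed

end

section \<open>The controlled system\<close>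

text \<open>
  Turns the count of requests into a sum of indicators, which can be integrated term by term. An
  infinite set satisfies the inequality because \<open>card\<close> sends it to \<open>0\<close>.
\<close>

lemma card_le_suminf_indicator:
  fixes X :: "nat set"
  shows "of_nat (card X) \<le> (\<Sum>n. indicator X n :: ennreal)"
proof (cases "finite X")
  case True
  have "(\<Sum>n. indicator X n :: ennreal) = (\<Sum>n\<in>X. indicator X n)"
    by (rule suminf_finite[OF True]) auto
  then show ?thesis by simp
qed simp

context loss_model
begin

lemma in_service_measurable:
  assumes "i \<in> {1..m}" and [measurable]: "\<And>n. D i n \<in> measurable M (count_space UNIV)"
  shows "in_service A S D i t \<in> measurable M (count_space UNIV)"
proof -
  note [measurable] = arrival_epoch_measurable[OF assms(1)] service_measurable[OF assms(1)]
  show ?thesis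
    unfolding in_service_def[abs_def] by (intro measurable_card) simp
qed

lemma nn_integral_in_service_le:
  assumes i: "i \<in> {1..m}" and t: "0 \<le> t"
  shows "(\<integral>\<^sup>+\<omega>. ennreal (real (in_service A S D i t \<omega>)) \<partial>M)
    \<le> ennreal (lam i / mu i * (1 - exp (- mu i * t)))"
proof -
  note [measurable] = arrival_epoch_measurable[OF i] service_measurable[OF i]
  let ?E = "\<lambda>n. {\<omega> \<in> space M. arrival_epoch A i n \<omega> \<le> t \<and> t < arrival_epoch A i n \<omega> + S i n \<omega>}"
  have "(\<integral>\<^sup>+\<omega>. ennreal (real (in_service A S D i t \<omega>)) \<partial>M) \<le> (\<integral>\<^sup>+\<omega>. (\<Sum>n. indicator (?E n) \<omega>) \<partial>M)"
  proof (intro nn_integral_mono)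
    fix \<omega> assume \<omega>: "\<omega> \<in> space M"
    let ?X = "{n. D i n \<omega> \<and> arrival_epoch A i n \<omega> \<le> t \<and> t < arrival_epoch A i n \<omega> + S i n \<omega>}"
    have "ennreal (real (in_service A S D i t \<omega>)) \<le> (\<Sum>n. indicator ?X n)"
      using card_le_suminf_indicator[of ?X] by (simp add: in_service_def ennreal_of_nat_eq_real_of_nat)
    also have "\<dots> \<le> (\<Sum>n. indicator (?E n) \<omega>)"
      using \<omega> by (intro suminf_le) (auto simp: indicator_def)
    finally show "ennreal (real (in_service A S D i t \<omega>)) \<le> (\<Sum>n. indicator (?E n) \<omega>)" .
  qed
  also have "\<dots> = (\<Sum>n. \<integral>\<^sup>+\<omega>. indicator (?E n) \<omega> \<partial>M)"
    by (rule nn_integral_suminf) measurable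
  also have "\<dots> = (\<Sum>n. emeasure M (?E n))"
    by (intro suminf_cong nn_integral_indicator) measurable
  also have "\<dots> = ennreal (lam i / mu i * (1 - exp (- mu i * t)))"
    by (rule expected_uncontrolled_in_service[OF i t])
  finally show ?thesis .
qed

lemma
  assumes D: "\<And>n. D i n \<in> measurable M (count_space UNIV)"
    and i: "i \<in> {1..m}" and t: "0 \<le> t"
  shows in_service_integrable: "integrable M (\<lambda>\<omega>. real (in_service A S D i t \<omega>))"
    and expectation_in_service_le:
      "expectation (\<lambda>\<omega>. real (in_service A S D i t \<omega>)) \<le> lam i / mu i * (1 - exp (- mu i * t))"
proof -
  note [measurable] = in_service_measurable[of i D, OF i D]
  have meas: "(\<lambda>\<omega>. real (in_service A S D i t \<omega>)) \<in> borel_measurable M"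
    by measurable
  show "integrable M (\<lambda>\<omega>. real (in_service A S D i t \<omega>))"
    using nn_integral_in_service_le[OF i t, of D] meas
    by (intro integrableI_nonneg) (auto simp: top.not_eq_extremum intro: le_less_trans)
  have "0 \<le> lam i / mu i * (1 - exp (- mu i * t))"
    using i t less_imp_le[OF lam_pos] less_imp_le[OF mu_pos] by (intro mult_nonneg_nonneg) auto
  then show "expectation (\<lambda>\<omega>. real (in_service A S D i t \<omega>)) \<le> lam i / mu i * (1 - exp (- mu i * t))"
    using nn_integral_in_service_le[OF i t, of D] meas
    by (subst integral_eq_nn_integral) (auto intro: enn2real_leI)
qed

lemma reward_rate_integrable:
  assumes "feasible_policy M m b cap A S D" and "0 \<le> t"
  shows "integrable M (reward_rate m rew A S D t)"
  unfolding reward_rate_def[abs_def] using assms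
  by (intro Bochner_Integration.integrable_sum integrable_mult_right in_service_integrable)
     (auto simp: feasible_policy_def)

text \<open>
  \<open>E[x\<^sub>i] / \<rho>\<^sub>i\<close> is the mean occupancy relative to \<open>\<rho>\<^sub>i\<close>, the stationary mean when every request is
  accepted.
\<close>

lemma mean_occupancy_lp_feasible:
  assumes D: "feasible_policy M m b cap A S D" and t: "0 \<le> t" and rho: "rho = (\<lambda>i. lam i / mu i)"
  shows "lp_feasible m b cap rho (\<lambda>i. 1 - exp (- mu i * t))
    (\<lambda>i. expectation (\<lambda>\<omega>. real (in_service A S D i t \<omega>)) / rho i)"
proof -
  let ?x = "\<lambda>i \<omega>. real (in_service A S D i t \<omega>)"
  have meas: "D i n \<in> measurable M (count_space UNIV)" if "i \<in> {1..m}" for i n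
    using D that by (auto simp: feasible_policy_def)
  have pos: "0 < rho i" if "i \<in> {1..m}" for i
    using that lam_pos mu_pos by (simp add: rho)
  have int: "integrable M (?x i)" if "i \<in> {1..m}" for i
    using in_service_integrable[of D, OF meas[OF that] that t] .
  have "(\<Sum>i=1..m. cap i * rho i * (expectation (?x i) / rho i)) = (\<Sum>i=1..m. cap i * expectation (?x i))"
    using pos by (intro sum.cong) (auto simp: less_le)
  also have "\<dots> = expectation (\<lambda>\<omega>. \<Sum>i=1..m. cap i * ?x i \<omega>)"
    using int by (subst Bochner_Integration.integral_sum) auto
  also have "\<dots> \<le> expectation (\<lambda>_. b)"
    using D t int by (intro integral_mono_AE) (auto simp: feasible_policy_def)
  finally have "(\<Sum>i=1..m. cap i * rho i * (expectation (?x i) / rho i)) \<le> b"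
    by (simp add: prob_space)
  moreover have "0 \<le> expectation (?x i) / rho i \<and> expectation (?x i) / rho i \<le> 1 - exp (- mu i * t)"
    if i: "i \<in> {1..m}" for i
    using expectation_in_service_le[of D, OF meas[OF i] i t] pos[OF i]
    by (auto simp: rho[symmetric] fun_cong[OF rho, symmetric] pos_divide_le_eq mult.commute)
  ultimately show ?thesis by (simp add: lp_feasible_def)
qed

lemma expectation_reward_rate:
  assumes D: "feasible_policy M m b cap A S D" and t: "0 \<le> t" and rho: "rho = (\<lambda>i. lam i / mu i)"
  shows "expectation (reward_rate m rew A S D t)
    = lp_objective m rew rho (\<lambda>i. expectation (\<lambda>\<omega>. real (in_service A S D i t \<omega>)) / rho i)"
proof -
  have "integrable M (\<lambda>\<omega>. real (in_service A S D i t \<omega>))" if "i \<in> {1..m}" for i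
    using D that by (intro in_service_integrable t) (auto simp: feasible_policy_def)
  then have "expectation (reward_rate m rew A S D t)
      = (\<Sum>i=1..m. rew i * expectation (\<lambda>\<omega>. real (in_service A S D i t \<omega>)))"
    unfolding reward_rate_def[abs_def] by (subst Bochner_Integration.integral_sum) auto
  also have "\<dots> = lp_objective m rew rho (\<lambda>i. expectation (\<lambda>\<omega>. real (in_service A S D i t \<omega>)) / rho i)"
    unfolding lp_objective_def using lam_pos mu_pos
    by (intro sum.cong) (auto simp: rho less_le)
  finally show ?thesis .
qed

end

section \<open>Duality for the linear program\<close>

text \<open>
  Weak duality for arbitrary upper bounds on the variables. The dual constraints do not mention
  these bounds, so one pair \<open>(u, v)\<close> serves all of them.
\<close>

lemma lp_objective_le_scaled_dual:
  assumes "lp_feasible m b cap rho ub \<beta>" and "dual_feasible m cap rew rho (u, v)"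
  shows "lp_objective m rew rho \<beta> \<le> (\<Sum>i=1..m. v i * ub i) + u * b"
proof -
  have "lp_objective m rew rho \<beta> \<le> (\<Sum>i=1..m. v i * ub i + u * (cap i * rho i * \<beta> i))"
    unfolding lp_objective_def
  proof (rule sum_mono)
    fix i assume i: "i \<in> {1..m}"
    have \<beta>: "0 \<le> \<beta> i" "\<beta> i \<le> ub i" and v: "rew i * rho i \<le> v i + cap i * rho i * u" "0 \<le> v i"
      using assms i by (auto simp: lp_feasible_def dual_feasible_def)
    have "rew i * rho i * \<beta> i \<le> (v i + cap i * rho i * u) * \<beta> i"
      using v \<beta> by (intro mult_right_mono)
    also have "\<dots> = v i * \<beta> i + u * (cap i * rho i * \<beta> i)"
      by (simp add: algebra_simps)
    also have "\<dots> \<le> v i * ub i + u * (cap i * rho i * \<beta> i)"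
      using v \<beta> by (simp add: mult_left_mono)
    finally show "rew i * rho i * \<beta> i \<le> v i * ub i + u * (cap i * rho i * \<beta> i)" .
  qed
  also have "\<dots> = (\<Sum>i=1..m. v i * ub i) + u * (\<Sum>i=1..m. cap i * rho i * \<beta> i)"
    by (simp add: sum.distrib sum_distrib_left)
  also have "\<dots> \<le> (\<Sum>i=1..m. v i * ub i) + u * b"
    using assms by (auto simp: lp_feasible_def dual_feasible_def intro: mult_left_mono)
  finally show ?thesis .
qed

lemma sum_mult_fun_upd:
  fixes g \<alpha> :: "nat \<Rightarrow> real"
  assumes "finite I" "j \<in> I"
  shows "(\<Sum>i\<in>I. g i * (\<alpha>(j := \<alpha> j + x)) i) = (\<Sum>i\<in>I. g i * \<alpha> i) + g j * x"
proof -
  have "(\<Sum>i\<in>I. g i * (\<alpha>(j := \<alpha> j + x)) i) = (\<Sum>i\<in>I. g i * \<alpha> i + (if i = j then g j * x else 0))"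
    by (intro sum.cong) (auto simp: algebra_simps)
  then show ?thesis using assms by (simp add: sum.distrib)
qed

text \<open>If capacity is left over, increasing any useful variable below its bound improves the objective.\<close>

lemma knapsack_slack_imp_full:
  assumes opt: "is_arg_max (lp_objective m rew rho) (lp_feasible m b cap rho (\<lambda>i. 1)) \<alpha>"
    and slack: "(\<Sum>i=1..m. cap i * rho i * \<alpha> i) < b"
    and pos: "\<And>i. i \<in> {1..m} \<Longrightarrow> 0 < cap i * rho i"
    and j: "j \<in> {1..m}" "0 < rew j * rho j"
  shows "\<alpha> j = 1"
proof (rule ccontr)
  assume "\<alpha> j \<noteq> 1"
  have feas: "0 \<le> \<alpha> i \<and> \<alpha> i \<le> 1" if "i \<in> {1..m}" for i
    using opt that by (auto simp: is_arg_max_def lp_feasible_def)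
  \<comment> \<open>the largest increase of \<open>\<alpha> j\<close> that respects both its bound and the capacity\<close>
  define \<epsilon> where "\<epsilon> = min (1 - \<alpha> j) ((b - (\<Sum>i=1..m. cap i * rho i * \<alpha> i)) / (cap j * rho j))"
  have \<epsilon>: "0 < \<epsilon>" "\<epsilon> \<le> 1 - \<alpha> j" "cap j * rho j * \<epsilon> \<le> b - (\<Sum>i=1..m. cap i * rho i * \<alpha> i)"
  proof -
    show "0 < \<epsilon>"
      using feas[OF j(1)] \<open>\<alpha> j \<noteq> 1\<close> slack pos[OF j(1)] by (simp add: \<epsilon>_def)
    have "\<epsilon> \<le> (b - (\<Sum>i=1..m. cap i * rho i * \<alpha> i)) / (cap j * rho j)" by (simp add: \<epsilon>_def)
    then show "cap j * rho j * \<epsilon> \<le> b - (\<Sum>i=1..m. cap i * rho i * \<alpha> i)"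
      using pos[OF j(1)] by (simp add: pos_le_divide_eq mult.commute)
  qed (simp add: \<epsilon>_def)
  let ?\<beta> = "\<alpha>(j := \<alpha> j + \<epsilon>)"
  have shift: "(\<Sum>i=1..m. g i * ?\<beta> i) = (\<Sum>i=1..m. g i * \<alpha> i) + g j * \<epsilon>" for g
    by (rule sum_mult_fun_upd[OF finite_atLeastAtMost j(1)])
  have "lp_feasible m b cap rho (\<lambda>i. 1) ?\<beta>"
    using \<epsilon> feas[OF j(1)] feas unfolding lp_feasible_def shift by auto
  moreover have "lp_objective m rew rho \<alpha> < lp_objective m rew rho ?\<beta>"
    using \<epsilon> j(2) unfolding lp_objective_def shift by simp
  ultimately show False using opt by (auto simp: is_arg_max_def)
qed

text \<open>
  The greedy structure of an optimum: if class \<open>j\<close> earned more per unit of capacity than class \<open>k\<close>,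
  then moving a little capacity from \<open>k\<close> to \<open>j\<close> would improve the objective.
\<close>

lemma knapsack_exchange:
  assumes opt: "is_arg_max (lp_objective m rew rho) (lp_feasible m b cap rho (\<lambda>i. 1)) \<alpha>"
    and pos: "\<And>i. i \<in> {1..m} \<Longrightarrow> 0 < cap i * rho i"
    and j: "j \<in> {1..m}" "\<alpha> j < 1" and k: "k \<in> {1..m}" "0 < \<alpha> k"
  shows "rew j * rho j / (cap j * rho j) \<le> rew k * rho k / (cap k * rho k)"
proof (rule ccontr)
  let ?q = "\<lambda>i. rew i * rho i / (cap i * rho i)"
  assume "\<not> ?q j \<le> ?q k"
  then have q: "?q k < ?q j" and jk: "j \<noteq> k" by auto
  have feas: "0 \<le> \<alpha> i \<and> \<alpha> i \<le> 1" if "i \<in> {1..m}" for i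
    using opt that by (auto simp: is_arg_max_def lp_feasible_def)
  have cap: "(\<Sum>i=1..m. cap i * rho i * \<alpha> i) \<le> b"
    using opt by (auto simp: is_arg_max_def lp_feasible_def)
  \<comment> \<open>the largest amount of capacity that can be moved from \<open>k\<close> to \<open>j\<close>\<close>
  define \<epsilon> where "\<epsilon> = min ((1 - \<alpha> j) * (cap j * rho j)) (\<alpha> k * (cap k * rho k))"
  have \<epsilon>: "0 < \<epsilon>" using j k pos by (simp add: \<epsilon>_def)
  let ?x = "\<epsilon> / (cap j * rho j)" and ?y = "\<epsilon> / (cap k * rho k)"
  have x: "0 < ?x" "?x \<le> 1 - \<alpha> j" using \<epsilon> pos[OF j(1)]
    by (auto simp: \<epsilon>_def divide_le_eq simp del: mult_eq_0_iff zero_less_mult_iff)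
  have y: "0 < ?y" "?y \<le> \<alpha> k" using \<epsilon> pos[OF k(1)]
    by (auto simp: \<epsilon>_def divide_le_eq simp del: mult_eq_0_iff zero_less_mult_iff)
  let ?\<gamma> = "\<alpha>(j := \<alpha> j + ?x)"
  let ?\<beta> = "?\<gamma>(k := ?\<gamma> k + - ?y)"
  have shift: "(\<Sum>i=1..m. g i * ?\<beta> i) = (\<Sum>i=1..m. g i * \<alpha> i) + g j * ?x - g k * ?y" for g
    using sum_mult_fun_upd[OF finite_atLeastAtMost j(1), of g \<alpha> ?x]
      sum_mult_fun_upd[OF finite_atLeastAtMost k(1), of g ?\<gamma> "- ?y"] by simp
  have "cap j * rho j * ?x = \<epsilon>" "cap k * rho k * ?y = \<epsilon>"
    using pos[OF j(1)] pos[OF k(1)] by (auto simp: less_le)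
  then have "lp_feasible m b cap rho (\<lambda>i. 1) ?\<beta>"
    using x y jk feas[OF j(1)] feas[OF k(1)] feas cap unfolding lp_feasible_def shift by auto
  moreover have "lp_objective m rew rho \<alpha> < lp_objective m rew rho ?\<beta>"
  proof -
    have "rew j * rho j * ?x - rew k * rho k * ?y = \<epsilon> * (?q j - ?q k)"
      by (simp add: algebra_simps)
    also have "\<dots> > 0" using \<epsilon> q by simp
    finally show ?thesis unfolding lp_objective_def shift by simp
  qed
  ultimately show False using opt by (auto simp: is_arg_max_def)
qed

text \<open>
  The dual solution is explicit. The price \<open>u\<close> of capacity is \<open>0\<close> if capacity is left over, and
  otherwise the smallest reward per unit of capacity among the classes that are used; \<open>v\<close> is
  the amount, if any, by which the reward of a class exceeds the price of its capacity. Complementary slackness then follows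
  from the exchange argument and gives equality of the two objectives.
\<close>

lemma knapsack_strong_duality:
  assumes opt: "is_arg_max (lp_objective m rew rho) (lp_feasible m b cap rho (\<lambda>i. 1)) \<alpha>"
    and b: "0 < b"
    and pos: "\<And>i. i \<in> {1..m} \<Longrightarrow> 0 < cap i * rho i"
    and rew: "\<And>i. i \<in> {1..m} \<Longrightarrow> 0 \<le> rew i * rho i"
  obtains w where "dual_feasible m cap rew rho w" "dual_objective m b w = lp_objective m rew rho \<alpha>"
proof -
  have feas: "0 \<le> \<alpha> i \<and> \<alpha> i \<le> 1" if "i \<in> {1..m}" for i
    using opt that by (auto simp: is_arg_max_def lp_feasible_def)
  have cap: "(\<Sum>i=1..m. cap i * rho i * \<alpha> i) \<le> b"
    using opt by (auto simp: is_arg_max_def lp_feasible_def)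
  show ?thesis
  proof (cases "(\<Sum>i=1..m. cap i * rho i * \<alpha> i) < b")
    case True
    let ?v = "\<lambda>i. rew i * rho i"
    have "?v i = ?v i * \<alpha> i" if "i \<in> {1..m}" for i
      using knapsack_slack_imp_full[OF opt True pos that] rew[OF that] by (cases "?v i = 0") auto
    then have "(\<Sum>i=1..m. ?v i) = (\<Sum>i=1..m. ?v i * \<alpha> i)"
      by (intro sum.cong) auto
    then show ?thesis
      using rew by (intro that[of "(0, ?v)"]) (auto simp: dual_feasible_def dual_objective_def lp_objective_def)
  next
    case False
    with cap have tight: "(\<Sum>i=1..m. cap i * rho i * \<alpha> i) = b" by simp
    let ?K = "{k \<in> {1..m}. 0 < \<alpha> k}"
    let ?q = "\<lambda>i. rew i * rho i / (cap i * rho i)"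
    have "?K \<noteq> {}"
    proof
      assume "?K = {}"
      then have "\<alpha> i = 0" if "i \<in> {1..m}" for i using feas[OF that] that by force
      then have "(\<Sum>i=1..m. cap i * rho i * \<alpha> i) = 0" by simp
      then show False using tight b by simp
    qed
    then have "Min (?q ` ?K) \<in> ?q ` ?K" by (intro Min_in) auto
    then obtain k where k: "k \<in> {1..m}" "0 < \<alpha> k" and kmin: "Min (?q ` ?K) = ?q k" by auto
    have kle: "?q k \<le> ?q i" if "i \<in> {1..m}" "0 < \<alpha> i" for i
      unfolding kmin[symmetric] using that by (intro Min_le) auto
    let ?v = "\<lambda>i. max 0 (rew i * rho i - cap i * rho i * ?q k)"
    have q: "?q k * (cap i * rho i) \<le> rew i * rho i \<longleftrightarrow> ?q k \<le> ?q i"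
      "rew i * rho i \<le> ?q k * (cap i * rho i) \<longleftrightarrow> ?q i \<le> ?q k" if "i \<in> {1..m}" for i
      using pos[OF that] by (simp_all only: pos_le_divide_eq pos_divide_le_eq)
    have v: "?v i = rew i * rho i * \<alpha> i - ?q k * (cap i * rho i * \<alpha> i)" if i: "i \<in> {1..m}" for i
    proof -
      let ?d = "rew i * rho i - cap i * rho i * ?q k"
      \<comment> \<open>complementary slackness: by the exchange argument a class that is not fully used does not
        exceed the price, and by the choice of \<open>k\<close> a class that is used does not fall below it\<close>
      have "\<alpha> i = 0 \<and> ?d \<le> 0 \<or> \<alpha> i = 1 \<and> 0 \<le> ?d \<or> ?d = 0"
        using knapsack_exchange[OF opt pos i _ k] kle[OF i] q[OF i] feas[OF i]
        by (smt (verit) mult.commute)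
      then have "?v i = ?d * \<alpha> i" by auto
      then show ?thesis by (simp only: algebra_simps)
    qed
    have "(\<Sum>i=1..m. ?v i) = (\<Sum>i=1..m. rew i * rho i * \<alpha> i - ?q k * (cap i * rho i * \<alpha> i))"
      using v by (intro sum.cong) auto
    also have "\<dots> = lp_objective m rew rho \<alpha> - ?q k * b"
      unfolding lp_objective_def sum_subtractf sum_distrib_left[symmetric] tight ..
    finally have "dual_objective m b (?q k, ?v) = lp_objective m rew rho \<alpha>"
      by (simp add: dual_objective_def)
    moreover have "0 \<le> ?q k" using rew[OF k(1)] pos[OF k(1)] by (intro divide_nonneg_nonneg) auto
    then have "dual_feasible m cap rew rho (?q k, ?v)"
      by (auto simp: dual_feasible_def)
    ultimately show ?thesis using that by blast
  qed
qed

text \<open>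
  By the strong duality hypothesis the parts without \<open>e\<close> compare as required, so what remains is
  that scaling loses no more on the primal side than on the dual side plus \<open>u b E\<close>: the sum of
  \<open>r\<^sub>i \<rho>\<^sub>i \<alpha>\<^sub>i e\<^sub>i\<close> is at most that of \<open>v\<^sub>i e\<^sub>i\<close>, plus \<open>u b E\<close>. This is weak duality weighted by \<open>e\<close>.
  It is used with \<open>e\<^sub>i = e\<^bsup>-\<mu>\<^sub>i t\<^esup>\<close> and \<open>E = e\<^bsup>-\<mu>\<^sub>m\<^sub>i\<^sub>n t\<^esup>\<close>.
\<close>

lemma scaled_dual_le_scaled_primal:
  assumes feas: "lp_feasible m b cap rho (\<lambda>i. 1) \<alpha>"
    and dual: "dual_feasible m cap rew rho (u, v)"
    and strong: "dual_objective m b (u, v) \<le> lp_objective m rew rho \<alpha>"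
    and pos: "\<And>i. i \<in> {1..m} \<Longrightarrow> 0 \<le> cap i * rho i"
    and e: "\<And>i. i \<in> {1..m} \<Longrightarrow> 0 \<le> e i \<and> e i \<le> E" and E: "0 \<le> E"
  shows "(\<Sum>i=1..m. v i * (1 - e i)) + u * b
    \<le> (\<Sum>i=1..m. rew i * rho i * \<alpha> i * (1 - e i)) + u * b * E"
proof -
  have "(\<Sum>i=1..m. rew i * rho i * \<alpha> i * e i) \<le> (\<Sum>i=1..m. v i * e i + u * E * (cap i * rho i * \<alpha> i))"
  proof (rule sum_mono)
    fix i assume i: "i \<in> {1..m}"
    have \<alpha>: "0 \<le> \<alpha> i" "\<alpha> i \<le> 1" and v: "rew i * rho i \<le> v i + cap i * rho i * u" "0 \<le> v i" and u: "0 \<le> u"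
      using feas dual i by (auto simp: lp_feasible_def dual_feasible_def)
    have "rew i * rho i * (\<alpha> i * e i) \<le> (v i + cap i * rho i * u) * (\<alpha> i * e i)"
      using v \<alpha> e[OF i] by (intro mult_right_mono) auto
    also have "\<dots> = v i * (\<alpha> i * e i) + (u * (cap i * rho i * \<alpha> i)) * e i"
      by (simp add: algebra_simps)
    also have "\<dots> \<le> v i * (1 * e i) + (u * (cap i * rho i * \<alpha> i)) * E"
    proof (intro add_mono mult_left_mono mult_right_mono)
      show "0 \<le> u * (cap i * rho i * \<alpha> i)"
        by (intro mult_nonneg_nonneg[OF u] mult_nonneg_nonneg[OF pos[OF i]] \<alpha>)
    qed (use v \<alpha> e[OF i] in auto)
    finally show "rew i * rho i * \<alpha> i * e i \<le> v i * e i + u * E * (cap i * rho i * \<alpha> i)"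
      by (simp add: algebra_simps)
  qed
  also have "\<dots> = (\<Sum>i=1..m. v i * e i) + u * E * (\<Sum>i=1..m. cap i * rho i * \<alpha> i)"
    by (simp add: sum.distrib sum_distrib_left)
  also have "\<dots> \<le> (\<Sum>i=1..m. v i * e i) + u * E * b"
    using feas dual E by (auto simp: lp_feasible_def dual_feasible_def intro!: mult_left_mono)
  finally have "(\<Sum>i=1..m. rew i * rho i * \<alpha> i * e i) \<le> (\<Sum>i=1..m. v i * e i) + u * E * b" .
  then show ?thesis
    using strong by (simp add: dual_objective_def lp_objective_def algebra_simps sum_subtractf)
qed

lemma lp_value_le:
  assumes "0 \<le> b" and "\<And>i. i \<in> {1..m} \<Longrightarrow> 0 \<le> ub i"
    and "\<And>\<beta>. lp_feasible m b cap rho ub \<beta> \<Longrightarrow> lp_objective m rew rho \<beta> \<le> B"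
  shows "lp_value m b cap rew rho ub \<le> B"
  unfolding lp_value_def
proof (rule cSUP_least)
  have "lp_feasible m b cap rho ub (\<lambda>_. 0)" using assms by (simp add: lp_feasible_def)
  then show "{\<beta>. lp_feasible m b cap rho ub \<beta>} \<noteq> {}" by blast
qed (use assms in auto)

lemma lp_objective_le_box:
  assumes "lp_feasible m b cap rho ub \<beta>" and "\<And>i. i \<in> {1..m} \<Longrightarrow> 0 \<le> rew i * rho i"
  shows "lp_objective m rew rho \<beta> \<le> (\<Sum>i=1..m. rew i * rho i * ub i)"
  unfolding lp_objective_def using assms
  by (intro sum_mono mult_left_mono) (auto simp: lp_feasible_def)

lemma lp_objective_le_lp_value:
  assumes "lp_feasible m b cap rho ub \<beta>" and "\<And>i. i \<in> {1..m} \<Longrightarrow> 0 \<le> rew i * rho i"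
  shows "lp_objective m rew rho \<beta> \<le> lp_value m b cap rew rho ub"
  unfolding lp_value_def
proof (rule cSUP_upper)
  show "bdd_above (lp_objective m rew rho ` {\<beta>. lp_feasible m b cap rho ub \<beta>})"
    using lp_objective_le_box assms(2) by (intro bdd_aboveI2) blast
qed (use assms in auto)

section \<open>The bound on the expected reward rate\<close>

theorem theorem1:
  fixes M :: "'a measure"
    and m :: nat
    and b u t :: real
    and lam mu cap rew rho \<alpha> v :: "nat \<Rightarrow> real"
    and A S :: "nat \<Rightarrow> nat \<Rightarrow> 'a \<Rightarrow> real"
    and D :: "nat \<Rightarrow> nat \<Rightarrow> 'a \<Rightarrow> bool"
  assumes "loss_model M m b lam mu cap rew A S"
    and "rho = (\<lambda>i. lam i / mu i)"
    and "is_arg_max (lp_objective m rew rho) (lp_feasible m b cap rho (\<lambda>i. 1)) \<alpha>"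
    and "is_arg_min (dual_objective m b) (dual_feasible m cap rew rho) (u, v)"
    and "feasible_policy M m b cap A S D"
    and "0 \<le> t"
  shows "integrable M (reward_rate m rew A S D t) \<and>
    integral\<^sup>L M (reward_rate m rew A S D t)
      \<le> lp_value m b cap rew rho (\<lambda>i. 1 - exp (- mu i * t)) \<and>
    lp_value m b cap rew rho (\<lambda>i. 1 - exp (- mu i * t))
      \<le> min (\<Sum>i=1..m. rew i * rho i * (1 - exp (- mu i * t)))
            ((\<Sum>i=1..m. rew i * rho i * \<alpha> i * (1 - exp (- mu i * t)))
              + u * b * exp (- Min (mu ` {1..m}) * t))"
proof -
  interpret loss_model M m b lam mu cap rew A S by fact
  let ?ub = "\<lambda>i. 1 - exp (- mu i * t)"
  have rho: "0 < rho i" if "i \<in> {1..m}" for i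
    using that lam_pos mu_pos by (simp add: assms(2))
  have c: "0 \<le> rew i * rho i" and a: "0 < cap i * rho i" if "i \<in> {1..m}" for i
    using rho[OF that] rew_nonneg[OF that] cap_pos[OF that] by auto
  have ub: "0 \<le> ?ub i" if "i \<in> {1..m}" for i
    using mu_pos[OF that] assms(6) by simp
  have feas: "lp_feasible m b cap rho (\<lambda>i. 1) \<alpha>" and dual: "dual_feasible m cap rew rho (u, v)"
    using assms(3,4) by (auto simp: is_arg_max_def is_arg_min_def)
  have strong: "dual_objective m b (u, v) \<le> lp_objective m rew rho \<alpha>"
    using knapsack_strong_duality[OF assms(3) capacity_pos a c] assms(4)
    by (metis is_arg_min_linorder)
  have e: "0 \<le> exp (- mu i * t) \<and> exp (- mu i * t) \<le> exp (- Min (mu ` {1..m}) * t)"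
    if "i \<in> {1..m}" for i
  proof -
    have "Min (mu ` {1..m}) \<le> mu i" using that by (intro Min_le) auto
    then have "Min (mu ` {1..m}) * t \<le> mu i * t" using assms(6) by (rule mult_right_mono)
    then show ?thesis by simp
  qed
  have "expectation (reward_rate m rew A S D t) \<le> lp_value m b cap rew rho ?ub"
    unfolding expectation_reward_rate[OF assms(5,6,2)]
    by (rule lp_objective_le_lp_value[OF mean_occupancy_lp_feasible[OF assms(5,6,2)] c])
  moreover have "lp_value m b cap rew rho ?ub \<le> (\<Sum>i=1..m. rew i * rho i * ?ub i)"
    using capacity_pos ub c by (intro lp_value_le lp_objective_le_box) auto
  moreover have "lp_value m b cap rew rho ?ub \<le> (\<Sum>i=1..m. v i * ?ub i) + u * b"
    using capacity_pos ub dual by (intro lp_value_le lp_objective_le_scaled_dual) auto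
  moreover have "(\<Sum>i=1..m. v i * ?ub i) + u * b
      \<le> (\<Sum>i=1..m. rew i * rho i * \<alpha> i * ?ub i) + u * b * exp (- Min (mu ` {1..m}) * t)"
    using less_imp_le[OF a] e by (intro scaled_dual_le_scaled_primal[OF feas dual strong]) auto
  ultimately show ?thesis
    using reward_rate_integrable[OF assms(5,6)] by auto
qed

end
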